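(* Let $n\ge 1$ and $r\ge 1$. A weakly decreasing sequence $d=(d(1),\dots,d(n))$ of nonnegative integers is the degree partition of some $r$-graph on vertex set $[n]$ if and only if $d$ is majorized by some $r$-ideal partition of length $n$.
   Context: $S(n,r)$ is the set of $r$-element subsets of $[n]=\{1,\dots,n\}$; writing each as $(a_1<\dots<a_r)$, partially order $S(n,r)$ componentwise: $(a_1,\dots,a_r)\le(b_1,\dots,b_r)$ iff $a_i\le b_i$ for all $i$. An $r$-graph is a pair $([n],E)$ with $E\subseteq S(n,r)$; the degree of vertex $j$ is the number of edges containing $j$, the degree sequence is $(d_1,\dots,d_n)$ and the degree partition is the degree sequence rearranged in weakly decreasing order. An $r$-graph $([n],E)$ is an $r$-ideal if $E$ is an order ideal of $S(n,r)$ (i.e. $Y\in E$ and $X\le Y$ imply $X\in E$); the degree sequence of an $r$-ideal is called an $r$-ideal partition (it is weakly decreasing). For real sequences $a,b$ of length $n$ with $a[i],b[i]$ denoting the $i$-th largest components, $a$ majorizes $b$ if $\sum_{i=1}^k a[i]\ge\sum_{i=1}^k b[i]$ for $k=1,\dots,n$, with equality for $k=n$. *)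

theory Defs
  imports Complex_Main
begin

definition S :: "nat \<Rightarrow> nat \<Rightarrow> nat set set" where
  "S n r = {X. X \<subseteq> {1..n} \<and> card X = r}"

(* Elements of S n r are listed in increasing order, so list_all2 compares them componentwise. *)
definition comp_le :: "nat set \<Rightarrow> nat set \<Rightarrow> bool" where
  "comp_le X Y \<longleftrightarrow> list_all2 (\<le>) (sorted_list_of_set X) (sorted_list_of_set Y)"

(* The r-graph ([n], E) is represented by its edge set E together with the parameters n and r. *)
definition r_graph :: "nat \<Rightarrow> nat \<Rightarrow> nat set set \<Rightarrow> bool" where
  "r_graph n r E \<longleftrightarrow> E \<subseteq> S n r"

definition degree :: "nat set set \<Rightarrow> nat \<Rightarrow> nat" where
  "degree E j = card {X \<in> E. j \<in> X}"

(* Sequences of length n are lists; list position i < n holds the degree of vertex i + 1. *)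
definition degree_sequence :: "nat \<Rightarrow> nat set set \<Rightarrow> nat list" where
  "degree_sequence n E = map (degree E) [1..<Suc n]"

definition weakly_decreasing :: "'a::linorder list \<Rightarrow> bool" where
  "weakly_decreasing xs \<longleftrightarrow> sorted_wrt (\<ge>) xs"

definition decreasing_rearrangement :: "'a::linorder list \<Rightarrow> 'a list" where
  "decreasing_rearrangement xs = rev (sort xs)"

definition degree_partition :: "nat \<Rightarrow> nat set set \<Rightarrow> nat list" where
  "degree_partition n E = decreasing_rearrangement (degree_sequence n E)"

definition r_ideal :: "nat \<Rightarrow> nat \<Rightarrow> nat set set \<Rightarrow> bool" where
  "r_ideal n r E \<longleftrightarrow> r_graph n r E \<and> (\<forall>Y\<in>E. \<forall>X\<in>S n r. comp_le X Y \<longrightarrow> X \<in> E)"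

definition r_ideal_partition :: "nat \<Rightarrow> nat \<Rightarrow> nat list \<Rightarrow> bool" where
  "r_ideal_partition n r p \<longleftrightarrow> (\<exists>E. r_ideal n r E \<and> p = degree_sequence n E)"

(* The sum of the k largest components of a is the sum of the first k entries of
   its decreasing rearrangement. *)
definition majorizes :: "real list \<Rightarrow> real list \<Rightarrow> bool" where
  "majorizes a b \<longleftrightarrow>
     length a = length b \<and>
     (\<forall>k\<in>{1..length a}. sum_list (take k (decreasing_rearrangement a))
                        \<ge> sum_list (take k (decreasing_rearrangement b))) \<and>
     sum_list (take (length a) (decreasing_rearrangement a))
       = sum_list (take (length a) (decreasing_rearrangement b))"

end

theory Submission
  imports Defs "HOL-Combinatorics.List_Permutation"
begin

text \<open>Replacing a vertex \<open>a\<close> by a vertex \<open>b\<close> in a single edge moves one unit of degree from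
  \<open>a\<close> to \<open>b\<close>, and it is possible whenever \<open>a\<close> has larger degree than \<open>b\<close>. After relabelling, the
  degree sequence of the given \<open>r\<close>-graph is weakly decreasing. Consider all \<open>r\<close>-graphs whose degree
  sums over \<open>{1..k}\<close> dominate those of \<open>d\<close> for every \<open>k\<close>, with equal total. Among them, one that
  maximizes the total of these partial sums admits no replacement with \<open>b < a\<close>, so it is an ideal;
  one that minimizes the total has degree sequence \<open>d\<close>.\<close>

section \<open>Replacing a vertex of an edge\<close>

lemma finite_S: "finite (S n r)"
  by (rule finite_subset[of _ "Pow {1..n}"]) (auto simp: S_def)

lemma finite_r_graph: "r_graph n r E \<Longrightarrow> finite E"
  unfolding r_graph_def using finite_S finite_subset by blast

lemma finite_r_graphs: "finite {E. r_graph n r E}"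
  by (rule finite_subset[of _ "Pow (S n r)"]) (auto simp: r_graph_def finite_S)

definition replace :: "'a \<Rightarrow> 'a \<Rightarrow> 'a set \<Rightarrow> 'a set" where
  "replace a b X = insert b (X - {a})"

definition replace_edge :: "nat \<Rightarrow> nat \<Rightarrow> nat set \<Rightarrow> nat set set \<Rightarrow> nat set set" where
  "replace_edge a b X E = insert (replace a b X) (E - {X})"

lemma replace_in_S:
  assumes "X \<in> S n r" "a \<in> X" "b \<notin> X" "b \<in> {1..n}"
  shows "replace a b X \<in> S n r"
proof -
  have "finite X" using assms(1) by (auto simp: S_def intro: finite_subset)
  moreover from this have "card X > 0" using assms(2) by (auto simp: card_gt_0_iff)
  ultimately show ?thesis using assms by (auto simp: S_def replace_def)
qed

lemma r_graph_replace_edge: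
  assumes "r_graph n r E" "X \<in> E" "a \<in> X" "b \<notin> X" "b \<in> {1..n}"
  shows "r_graph n r (replace_edge a b X E)"
  using assms replace_in_S[of X n r a b] by (auto simp: r_graph_def replace_edge_def)

lemma degree_insert:
  assumes "finite E" "X \<notin> E"
  shows "degree (insert X E) i = degree E i + of_bool (i \<in> X)"
proof -
  have "{Y \<in> insert X E. i \<in> Y} =
      (if i \<in> X then insert X {Y \<in> E. i \<in> Y} else {Y \<in> E. i \<in> Y})" by auto
  then show ?thesis using assms by (simp add: degree_def)
qed

text \<open>The assumption \<open>replace a b X \<notin> E\<close> makes this an exchange of edges,
  so nothing merges. The old and new edges differ only at \<open>a\<close> and \<open>b\<close>. The
  additive form avoids truncated subtraction.\<close>

lemma degree_replace_edge:
  assumes "finite E" "X \<in> E" "a \<in> X" "b \<notin> X" "replace a b X \<notin> E"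
  shows "degree (replace_edge a b X E) i + of_bool (i = a) = degree E i + of_bool (i = b)"
proof -
  let ?F = "E - {X}"
  have "degree E i = degree ?F i + of_bool (i \<in> X)"
    using degree_insert[of ?F X i] assms by (simp add: insert_absorb)
  moreover have "degree (replace_edge a b X E) i = degree ?F i + of_bool (i \<in> replace a b X)"
    unfolding replace_edge_def using degree_insert[of ?F "replace a b X" i] assms by simp
  ultimately show ?thesis using assms(3,4) by (auto simp: replace_def)
qed

definition degree_sum :: "nat set set \<Rightarrow> nat \<Rightarrow> nat" where
  "degree_sum E k = (\<Sum>i=1..k. degree E i)"

text \<open>For \<open>b < a\<close> the sum rises by one exactly when \<open>b \<le> k < a\<close>;
  for \<open>a < b\<close> it falls by one exactly when \<open>a \<le> k < b\<close>. Both extremal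
  arguments rest on this.\<close>

lemma degree_sum_replace_edge:
  assumes "finite E" "X \<in> E" "a \<in> X" "b \<notin> X" "replace a b X \<notin> E" "a \<ge> 1" "b \<ge> 1"
  shows "degree_sum (replace_edge a b X E) k + of_bool (a \<le> k) = degree_sum E k + of_bool (b \<le> k)"
proof -
  have s: "(\<Sum>i=1..k. of_bool (i = c)) = (of_bool (c \<le> k) :: nat)" if "c \<ge> 1" for c :: nat
    using that by (simp add: of_bool_def)
  have "(\<Sum>i=1..k. degree (replace_edge a b X E) i + of_bool (i = a)) =
        (\<Sum>i=1..k. degree E i + of_bool (i = b))"
    by (intro sum.cong refl degree_replace_edge assms)
  then show ?thesis using assms(6,7) by (simp only: sum.distrib s degree_sum_def)
qed

text \<open>Edges containing both vertices count equally in both degrees, so more edges contain only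
  \<open>a\<close> than only \<open>b\<close>. Replacement is injective on the former, hence cannot
  map all of them into the latter. An image outside \<open>?B\<close> is not an edge at all, since
  it contains \<open>b\<close> and misses \<open>a\<close>.\<close>

lemma exists_replacement:
  assumes "finite E" "degree E b < degree E a"
  obtains X where "X \<in> E" "a \<in> X" "b \<notin> X" "replace a b X \<notin> E"
proof -
  let ?A = "{X \<in> E. a \<in> X \<and> b \<notin> X}" and ?B = "{X \<in> E. b \<in> X \<and> a \<notin> X}"
    and ?C = "{X \<in> E. a \<in> X \<and> b \<in> X}"
  have "degree E a = card (?A \<union> ?C)" "degree E b = card (?B \<union> ?C)"
    unfolding degree_def by (auto intro!: arg_cong[where f = card])
  moreover have "card (?A \<union> ?C) = card ?A + card ?C" "card (?B \<union> ?C) = card ?B + card ?C"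
    using assms(1) by (auto intro!: card_Un_disjoint)
  ultimately have less: "card ?B < card ?A" using assms(2) by simp
  have "inj_on (replace a b) ?A"
  proof (rule inj_on_inverseI)
    show "replace b a (replace a b X) = X" if "X \<in> ?A" for X
      using that by (auto simp: replace_def)
  qed
  then have "\<not> replace a b ` ?A \<subseteq> ?B"
    using less assms(1) card_inj_on_le[of "replace a b" ?A ?B] by auto
  then obtain X where "X \<in> ?A" "replace a b X \<notin> ?B" by blast
  then show ?thesis using that[of X] by (auto simp: replace_def)
qed

section \<open>Extremal graphs\<close>

text \<open>A version of majorization that sums over the first \<open>k\<close> vertices rather than
  the \<open>k\<close> largest degrees, so no sorting interferes when a vertex is replaced.\<close>

definition dominating :: "nat \<Rightarrow> nat \<Rightarrow> (nat \<Rightarrow> nat) \<Rightarrow> nat set set \<Rightarrow> bool" where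
  "dominating n r \<delta> E \<longleftrightarrow> r_graph n r E \<and> (\<forall>k\<in>{1..n}. (\<Sum>i=1..k. \<delta> i) \<le> degree_sum E k) \<and>
     degree_sum E n = (\<Sum>i=1..n. \<delta> i)"

lemma finite_dominating: "finite {E. dominating n r \<delta> E}"
  by (rule finite_subset[OF _ finite_r_graphs]) (auto simp: dominating_def)

text \<open>To descend from \<open>Y\<close> to a componentwise smaller \<open>X\<close>, lower the
  sorted entries one at a time, smallest first. Each change is a replacement by a smaller
  vertex.\<close>

lemma closed_imp_r_ideal:
  assumes E: "r_graph n r E"
    and closed: "\<And>X a b. \<lbrakk>X \<in> E; a \<in> X; b \<notin> X; 1 \<le> b; b < a\<rbrakk> \<Longrightarrow> replace a b X \<in> E"
  shows "r_ideal n r E"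
proof -
  \<comment> \<open>\<open>zs\<close> is the prefix already lowered to its entries in
    \<open>X\<close>; \<open>xs\<close> and \<open>ys\<close> are the remaining entries of
    \<open>X\<close> and \<open>Y\<close>.\<close>
  have key: "set (zs @ xs) \<in> E"
    if "list_all2 (\<le>) xs ys" "sorted_wrt (<) (zs @ xs)" "sorted_wrt (<) (zs @ ys)"
      "set (zs @ ys) \<in> E" "0 \<notin> set xs" for zs xs ys
    using that
  proof (induction xs ys arbitrary: zs rule: list_all2_induct)
    case Nil
    then show ?case by simp
  next
    case (Cons x xs y ys)
    have "set (zs @ x # ys) \<in> E"
    proof (cases "x = y")
      case False
      with Cons have "x < y" by simp
      \<comment> \<open>\<open>x\<close> exceeds everything in \<open>zs\<close>, and
        \<open>x < y\<close> lies below all of \<open>ys\<close>, so it is a new vertex.\<close>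
      moreover from this have "x \<notin> set (zs @ y # ys)"
        using Cons.prems by (force simp: sorted_wrt_append)
      moreover have "replace y x (set (zs @ y # ys)) = set (zs @ x # ys)"
        using Cons.prems by (force simp: replace_def sorted_wrt_append)
      moreover have "1 \<le> x" using Cons.prems by (cases x) auto
      ultimately show ?thesis
        using closed[of "set (zs @ y # ys)" y x] Cons.prems by auto
    qed (use Cons in simp)
    moreover have "sorted_wrt (<) (zs @ x # ys)"
      using Cons.prems \<open>x \<le> y\<close> by (fastforce simp: sorted_wrt_append)
    ultimately have "set ((zs @ [x]) @ xs) \<in> E"
      using Cons.prems by (intro Cons.IH) auto
    then show ?case by simp
  qed
  have "X \<in> E" if "Y \<in> E" "X \<in> S n r" "comp_le X Y" for X Y
  proof -
    have "Y \<in> S n r" using E that(1) by (auto simp: r_graph_def)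
    with that(2) have "finite X" "finite Y" "0 \<notin> X"
      by (auto simp: S_def intro: finite_subset)
    then show ?thesis
      using key[of "sorted_list_of_set X" "sorted_list_of_set Y" "[]"] that
      by (simp add: comp_le_def)
  qed
  with E show ?thesis by (auto simp: r_ideal_def)
qed

lemma dominating_ideal:
  assumes "dominating n r \<delta> E"
  obtains F where "dominating n r \<delta> F" "r_ideal n r F"
    "\<And>a b. \<lbrakk>1 \<le> b; b < a; a \<le> n\<rbrakk> \<Longrightarrow> degree F a \<le> degree F b"
proof -
  let ?m = "\<lambda>F. \<Sum>k=1..n. degree_sum F k"
  let ?A = "{F. dominating n r \<delta> F}"
  have "Max (?m ` ?A) \<in> ?m ` ?A"
    using assms finite_dominating by (intro Max_in) auto
  then obtain F where F: "dominating n r \<delta> F" and "?m F = Max (?m ` ?A)" by auto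
  then have max: "?m G \<le> ?m F" if "dominating n r \<delta> G" for G
    using that finite_dominating by simp
  have graph: "r_graph n r F" and fin: "finite F"
    using F finite_r_graph by (auto simp: dominating_def)
  have closed: "replace a b X \<in> F" if X: "X \<in> F" "a \<in> X" "b \<notin> X" "1 \<le> b" "b < a" for X a b
  proof (rule ccontr)
    assume notin: "replace a b X \<notin> F"
    have a: "a \<le> n" using graph X by (force simp: r_graph_def S_def)
    let ?G = "replace_edge a b X F"
    have sums: "degree_sum ?G k + of_bool (a \<le> k) = degree_sum F k + of_bool (b \<le> k)" for k
      using X notin fin by (intro degree_sum_replace_edge) auto
    have le: "degree_sum F k \<le> degree_sum ?G k" for k
      using sums[of k] \<open>b < a\<close> by (auto simp: of_bool_def split: if_splits)
    have "degree_sum ?G n = degree_sum F n" using sums[of n] a \<open>b < a\<close> by simp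
    moreover have "r_graph n r ?G" using graph X a by (intro r_graph_replace_edge) auto
    ultimately have "dominating n r \<delta> ?G"
      using F le order_trans unfolding dominating_def by metis
    moreover have "?m F < ?m ?G"
    proof (rule sum_strict_mono_ex1)
      show "\<exists>k\<in>{1..n}. degree_sum F k < degree_sum ?G k"
        \<comment> \<open>At \<open>k = b\<close> only the indicator of \<open>b\<close> is 1, so
          the sum strictly rises.\<close>
        using sums[of b] X a by (intro bexI[of _ b]) auto
    qed (use le in auto)
    ultimately show False using max[of ?G] by simp
  qed
  \<comment> \<open>A larger degree at \<open>a\<close> would supply a replacement outside
    \<open>F\<close>, against \<open>closed\<close>.\<close>
  have "degree F a \<le> degree F b" if "1 \<le> b" "b < a" "a \<le> n" for a b
    using exists_replacement[OF fin, of b a] closed[of _ a b] that by (metis not_less)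
  then show ?thesis using that F closed_imp_r_ideal[OF graph closed] by blast
qed

lemma dominating_realizes:
  assumes "dominating n r \<delta> E"
    and decr: "\<And>a b. \<lbrakk>1 \<le> a; a < b; b \<le> n\<rbrakk> \<Longrightarrow> \<delta> b \<le> \<delta> a"
  obtains F where "r_graph n r F" "\<And>i. i \<in> {1..n} \<Longrightarrow> degree F i = \<delta> i"
proof -
  let ?m = "\<lambda>F. \<Sum>k=1..n. degree_sum F k"
  obtain F where F: "dominating n r \<delta> F"
    and min: "\<And>G. dominating n r \<delta> G \<Longrightarrow> ?m F \<le> ?m G"
    using ex_has_least_nat[of "dominating n r \<delta>" E ?m] assms(1) by blast
  have graph: "r_graph n r F" and fin: "finite F"
    using F finite_r_graph by (auto simp: dominating_def)
  have total: "(\<Sum>i=1..n. degree F i) = (\<Sum>i=1..n. \<delta> i)"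
    and pre: "\<And>k. k \<in> {1..n} \<Longrightarrow> (\<Sum>i=1..k. \<delta> i) \<le> (\<Sum>i=1..k. degree F i)"
    using F by (auto simp: dominating_def degree_sum_def)
  \<comment> \<open>Since the totals agree, it suffices to exclude a deficit. Given one, a unit of
    degree is moved from an earlier surplus to the first deficit, contradicting minimality.\<close>
  have ge: "\<delta> i \<le> degree F i" if "i \<in> {1..n}" for i
  proof (rule ccontr)
    assume "\<not> \<delta> i \<le> degree F i"
    define Q where "Q b \<longleftrightarrow> b \<in> {1..n} \<and> degree F b < \<delta> b" for b
    define b where "b = (LEAST b. Q b)"
    have "Q i" using that \<open>\<not> _\<close> by (simp add: Q_def)
    then have "Q b" unfolding b_def by (rule LeastI)
    then have b: "b \<in> {1..n}" "degree F b < \<delta> b" by (auto simp: Q_def)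
    have below: "\<delta> k \<le> degree F k" if "1 \<le> k" "k < b" for k
      using not_less_Least[of k Q] that b by (auto simp: Q_def b_def)
    \<comment> \<open>Without a surplus before \<open>b\<close>, the deficit at \<open>b\<close>
      would push the partial sum up to \<open>b\<close> below that of \<delta>.\<close>
    have "\<exists>a\<in>{1..<b}. \<delta> a < degree F a"
    proof (rule ccontr)
      assume "\<not> ?thesis"
      then have "(\<Sum>i=1..b. degree F i) < (\<Sum>i=1..b. \<delta> i)"
        using b by (intro sum_strict_mono_ex1) (force simp: le_less)+
      with pre[of b] b show False by simp
    qed
    then obtain a where a: "1 \<le> a" "a < b" "\<delta> a < degree F a" by auto
    \<comment> \<open>The chain is
      \<open>degree F b < \<delta> b \<le> \<delta> a < degree F a\<close>.\<close>
    have "degree F b < degree F a" using a b decr[of a b] by auto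
    then obtain X where X: "X \<in> F" "a \<in> X" "b \<notin> X" "replace a b X \<notin> F"
      using exists_replacement[OF fin] by blast
    let ?G = "replace_edge a b X F"
    have sums: "degree_sum ?G k + of_bool (a \<le> k) = degree_sum F k + of_bool (b \<le> k)" for k
      using X a b fin by (intro degree_sum_replace_edge) auto
    have le: "degree_sum ?G k \<le> degree_sum F k" for k
      using sums[of k] \<open>a < b\<close> by (auto simp: of_bool_def split: if_splits)
    have "(\<Sum>i=1..k. \<delta> i) \<le> degree_sum ?G k" if k: "k \<in> {1..n}" for k
    \<comment> \<open>Only these sums drop, by one. They have slack: \<open>a\<close> has a surplus
      and no vertex before \<open>b\<close> has a deficit.\<close>
    proof (cases "a \<le> k \<and> k < b")
      case True
      then have "(\<Sum>i=1..k. \<delta> i) < degree_sum F k"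
        unfolding degree_sum_def using a below by (intro sum_strict_mono_ex1) auto
      with sums[of k] True show ?thesis by simp
    next
      case False
      then have "degree_sum ?G k = degree_sum F k" using sums[of k] \<open>a < b\<close> by auto
      with pre[OF k] show ?thesis by (simp add: degree_sum_def)
    qed
    moreover have "r_graph n r ?G" using graph X b by (intro r_graph_replace_edge) auto
    moreover have "degree_sum ?G n = degree_sum F n" using sums[of n] a b by simp
    ultimately have "dominating n r \<delta> ?G"
      using F by (simp add: dominating_def)
    moreover have "?m ?G < ?m F"
    proof (rule sum_strict_mono_ex1)
      show "\<exists>k\<in>{1..n}. degree_sum ?G k < degree_sum F k"
        using sums[of a] a b by (intro bexI[of _ a]) auto
    qed (use le in auto)
    ultimately show False using min[of ?G] by simp
  qed
  have "degree F i = \<delta> i" if "i \<in> {1..n}" for i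
  proof (rule ccontr)
    assume "degree F i \<noteq> \<delta> i"
    with ge[OF that] have "\<delta> i < degree F i" by simp
    with ge that have "(\<Sum>i=1..n. \<delta> i) < (\<Sum>i=1..n. degree F i)"
      by (intro sum_strict_mono_ex1) blast+
    with total show False by simp
  qed
  with graph that show ?thesis by blast
qed

section \<open>Rearrangements and majorization\<close>

lemma length_degree_sequence [simp]: "length (degree_sequence n E) = n"
  by (simp add: degree_sequence_def)

lemma nth_degree_sequence: "i < n \<Longrightarrow> degree_sequence n E ! i = degree E (Suc i)"
  by (simp add: degree_sequence_def del: upt_Suc)

lemma mset_decreasing_rearrangement [simp]: "mset (decreasing_rearrangement xs) = mset xs"
  by (simp add: decreasing_rearrangement_def)

lemma length_decreasing_rearrangement [simp]: "length (decreasing_rearrangement xs) = length xs"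
  by (simp add: decreasing_rearrangement_def)

lemma decreasing_rearrangement_id:
  assumes "weakly_decreasing xs"
  shows "decreasing_rearrangement xs = xs"
proof -
  have "sort xs = rev xs"
    using assms by (intro properties_for_sort) (auto simp: weakly_decreasing_def sorted_wrt_rev)
  then show ?thesis by (simp add: decreasing_rearrangement_def)
qed

lemma decreasing_rearrangement_map_real:
  "decreasing_rearrangement (map real xs) = map real (decreasing_rearrangement xs)"
proof -
  have "sort (map real xs) = map real (sort xs)"
    by (intro properties_for_sort) (auto simp: sorted_map intro: sorted_wrt_mono_rel[of _ "(\<le>)"])
  then show ?thesis by (simp add: decreasing_rearrangement_def rev_map)
qed

lemma sum_list_take: "k \<le> length xs \<Longrightarrow> sum_list (take k xs) = (\<Sum>i=1..k. xs ! (i - 1))"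
  for xs :: "nat list"
  by (simp add: sum_list_sum_nth min_absorb2 sum.atLeast1_atMost_eq atLeast0LessThan)

text \<open>This restates majorization in the form of \<open>dominating\<close>: sums of natural
  numbers, indexed by vertices from 1.\<close>

lemma majorizes_map_real_iff:
  assumes "length p = n" "length d = n" "weakly_decreasing d"
  shows "majorizes (map real p) (map real d) \<longleftrightarrow>
    (\<forall>k\<in>{1..n}. (\<Sum>i=1..k. d ! (i - 1)) \<le> (\<Sum>i=1..k. decreasing_rearrangement p ! (i - 1))) \<and>
    (\<Sum>i=1..n. decreasing_rearrangement p ! (i - 1)) = (\<Sum>i=1..n. d ! (i - 1))"
proof -
  have real: "sum_list (take k (decreasing_rearrangement (map real xs)))
      = real (\<Sum>i=1..k. decreasing_rearrangement xs ! (i - 1))" if "k \<le> length xs" for k xs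
  proof -
    have "sum_list (map real ys) = real (sum_list ys)" for ys
      by (induction ys) auto
    then show ?thesis
      using that by (simp add: decreasing_rearrangement_map_real take_map sum_list_take)
  qed
  show ?thesis
    unfolding majorizes_def
    using assms by (simp add: real decreasing_rearrangement_id del: of_nat_sum take_all take_all_iff)
qed

lemma relabel_degree_sequence:
  assumes E: "r_graph n r E" and "mset ys = mset (degree_sequence n E)"
  obtains F where "r_graph n r F" "degree_sequence n F = ys"
proof -
  obtain p where p: "p permutes {..<n}" and ys: "permute_list p (degree_sequence n E) = ys"
    using mset_eq_permutation[OF assms(2)] by auto
  \<comment> \<open>List positions start at 0 and vertices at 1, so \<open>p\<close> is conjugated
    by the shift.\<close>
  define f where "f i = Suc (p (i - 1))" for i
  have f: "bij_betw f {1..n} {1..n}"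
  proof -
    have "bij_betw (\<lambda>i. i - 1) {1..n} {..<n}"
      by (rule bij_betw_byWitness[of _ Suc]) auto
    moreover have "bij_betw Suc {..<n} {1..n}"
      by (rule bij_betw_byWitness[of _ "\<lambda>i. i - 1"]) auto
    ultimately have "bij_betw (Suc \<circ> (p \<circ> (\<lambda>i. i - 1))) {1..n} {1..n}"
      using permutes_imp_bij[OF p] bij_betw_trans by blast
    then show ?thesis by (simp add: f_def[abs_def] comp_def)
  qed
  \<comment> \<open>Each edge is pulled back along \<open>f\<close>, so vertex \<open>i\<close>
    inherits the degree of \<open>f i\<close>. This matches \<open>permute_list\<close>, which puts
    entry \<open>p i\<close> at position \<open>i\<close>.\<close>
  define g where "g X = {i \<in> {1..n}. f i \<in> X}" for X
  have sub: "X \<subseteq> {1..n}" if "X \<in> E" for X using E that by (auto simp: r_graph_def S_def)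
  have img: "f ` g X = X" if "X \<in> E" for X
  proof -
    have "f ` g X = f ` {1..n} \<inter> X" unfolding g_def by blast
    then show ?thesis using sub[OF that] bij_betw_imp_surj_on[OF f] by auto
  qed
  have inj: "inj_on g E" by (rule inj_on_inverseI[of _ "image f"]) (rule img)
  have "r_graph n r (g ` E)"
  proof -
    have "card (g X) = r" if "X \<in> E" for X
    proof -
      have "inj_on f (g X)" using f by (auto simp: bij_betw_def g_def intro: inj_on_subset)
      then have "card (f ` g X) = card (g X)" by (rule card_image)
      then show ?thesis using img[OF that] E that by (auto simp: r_graph_def S_def)
    qed
    then show ?thesis by (auto simp: r_graph_def S_def g_def)
  qed
  moreover have "degree_sequence n (g ` E) = ys"
  proof (rule nth_equalityI)
    show "length (degree_sequence n (g ` E)) = length ys" using ys by auto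
  next
    fix i assume "i < length (degree_sequence n (g ` E))"
    then have i: "i < n" by simp
    have pi: "p i < n" using permutes_in_image[OF p, of i] i by simp
    have "{X \<in> g ` E. Suc i \<in> X} = g ` {X \<in> E. Suc (p i) \<in> X}"
      using i by (auto simp: g_def f_def)
    moreover have "inj_on g {X \<in> E. Suc (p i) \<in> X}" using inj by (rule inj_on_subset) auto
    ultimately have "degree (g ` E) (Suc i) = degree E (Suc (p i))"
      by (simp add: degree_def card_image)
    then show "degree_sequence n (g ` E) ! i = ys ! i"
      using i pi p ys by (auto simp: nth_degree_sequence permute_list_nth)
  qed
  ultimately show ?thesis by (rule that)
qed

lemma degree_sum_eq:
  "k \<le> n \<Longrightarrow> degree_sum E k = (\<Sum>i=1..k. degree_sequence n E ! (i - 1))"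
  unfolding degree_sum_def by (intro sum.cong) (auto simp: nth_degree_sequence)

theorem theorem1p5:
  fixes n r :: nat and d :: "nat list"
  assumes "n \<ge> 1" and "r \<ge> 1"
    and "length d = n" and "weakly_decreasing d"
  shows "(\<exists>E. r_graph n r E \<and> degree_partition n E = d) \<longleftrightarrow>
         (\<exists>p. r_ideal_partition n r p \<and> majorizes (map real p) (map real d))"
proof
  assume "\<exists>E. r_graph n r E \<and> degree_partition n E = d"
  then obtain E where "r_graph n r E" "mset d = mset (degree_sequence n E)"
    by (metis degree_partition_def mset_decreasing_rearrangement)
  then obtain E' where E': "r_graph n r E'" "degree_sequence n E' = d"
    using relabel_degree_sequence by metis
  \<comment> \<open>All the partial sums are equal here.\<close>
  then have "dominating n r (\<lambda>i. d ! (i - 1)) E'"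
    by (auto simp: dominating_def degree_sum_eq[of _ n])
  then obtain F where F: "dominating n r (\<lambda>i. d ! (i - 1)) F" "r_ideal n r F"
    and decr: "\<And>a b. \<lbrakk>1 \<le> b; b < a; a \<le> n\<rbrakk> \<Longrightarrow> degree F a \<le> degree F b"
    using dominating_ideal by blast
  \<comment> \<open>For decreasing degrees the first \<open>k\<close> are the \<open>k\<close>
    largest, so domination is majorization.\<close>
  have "weakly_decreasing (degree_sequence n F)"
    using decr by (auto simp: weakly_decreasing_def sorted_wrt_iff_nth_less nth_degree_sequence)
  then have "decreasing_rearrangement (degree_sequence n F) = degree_sequence n F"
    by (rule decreasing_rearrangement_id)
  with F(1) have "majorizes (map real (degree_sequence n F)) (map real d)"
    using assms by (simp add: majorizes_map_real_iff[of _ n] dominating_def degree_sum_eq[of _ n])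
  with F(2) show "\<exists>p. r_ideal_partition n r p \<and> majorizes (map real p) (map real d)"
    by (auto simp: r_ideal_partition_def)
next
  assume "\<exists>p. r_ideal_partition n r p \<and> majorizes (map real p) (map real d)"
  then obtain E where E: "r_graph n r E"
    and maj: "majorizes (map real (degree_sequence n E)) (map real d)"
    by (auto simp: r_ideal_partition_def r_ideal_def)
  \<comment> \<open>Relabelling places the \<open>k\<close> largest degrees on the vertices up to
    \<open>k\<close>, which turns majorization into domination.\<close>
  obtain E' where E': "r_graph n r E'"
    "degree_sequence n E' = decreasing_rearrangement (degree_sequence n E)"
    using relabel_degree_sequence[OF E] mset_decreasing_rearrangement by metis
  have "dominating n r (\<lambda>i. d ! (i - 1)) E'"
    using maj E' assms
    by (simp add: majorizes_map_real_iff[of _ n] dominating_def degree_sum_eq[of _ n])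
  moreover have "d ! (b - 1) \<le> d ! (a - 1)" if "1 \<le> a" "a < b" "b \<le> n" for a b
    using assms(3,4) that by (auto simp: weakly_decreasing_def sorted_wrt_iff_nth_less)
  ultimately obtain F where F: "r_graph n r F" "\<And>i. i \<in> {1..n} \<Longrightarrow> degree F i = d ! (i - 1)"
    using dominating_realizes by blast
  have "degree_sequence n F = d"
    using F(2) assms(3) by (intro nth_equalityI) (auto simp: nth_degree_sequence)
  then have "degree_partition n F = d"
    using assms(4) by (simp add: degree_partition_def decreasing_rearrangement_id)
  with F(1) show "\<exists>E. r_graph n r E \<and> degree_partition n E = d" by blast
qed

end
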